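(* Let $G$ be a bipartite graph with bipartition $X\cup Y$, and let $m=|E(G)|$, $n=|V(G)|$. The following hold. \begin{enumerate} \item If $|Y|$ is even, then $G$ admits an $\varepsilon$-factorization with error matrix $E$ such that $\|E\|_0=m$ and $\varepsilon=\frac{m}{n^2}$. \item If $y_0\in Y$ and $|Y\setminus\{y_0\}|$ is even, then $G$ admits an $\varepsilon$-factorization with error matrix $E$ such that $\|E\|_0=m+d_G(y_0)$ and $\varepsilon=\frac{m+d_G(y_0)}{n^2}$. \end{enumerate}
   Context: All graphs are finite, simple and undirected; $A(H)$ is the adjacency matrix of $H$ and $d_G(y)$ the degree of $y$ in $G$. Let $0\le \varepsilon\le 1$. Fix an ordering $v_1,\dots,v_n$ of $V(G)$. An $\varepsilon$-factorization of $G$ (equivalently, of $A(G)$) with error matrix $E$ is a triple $(H,K,E)$ where $H$ and $K$ are simple graphs on $V(G)$, $E\in\{0,1\}^{n\times n}$ satisfies $\|E\|_0\le\varepsilon n^2$, and $(A(H)A(K))_{ij}=A(G)_{ij}$ for every $(i,j)$ with $E_{ij}=0$. Here $\|E\|_0$ is the number of nonzero entries of $E$. *)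

theory Defs
  imports "Graph_Theory.Pair_Digraph" "Jordan_Normal_Form.Matrix"
begin

text \<open>
  The locale \<open>pair_graph\<close> describes finite, simple, undirected graphs: a finite vertex set
  together with an irreflexive symmetric arc relation on it.  An undirected edge therefore
  corresponds to two arcs, and both the out-degree and the in-degree of a vertex are its degree.
\<close>

definition edges :: "'a pair_pre_digraph \<Rightarrow> 'a set set" where
  "edges G = {{u, v} | u v. (u, v) \<in> parcs G}"

definition degree :: "'a pair_pre_digraph \<Rightarrow> 'a \<Rightarrow> nat" where
  "degree G v = out_degree (with_proj G) v"

definition bipartition :: "'a pair_pre_digraph \<Rightarrow> 'a set \<Rightarrow> 'a set \<Rightarrow> bool" where
  "bipartition G X Y \<longleftrightarrow>
     X \<union> Y = pverts G \<and> X \<inter> Y = {} \<and>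
     (\<forall>(u, v) \<in> parcs G. u \<in> X \<and> v \<in> Y \<or> u \<in> Y \<and> v \<in> X)"

definition vertex_ordering :: "'a pair_pre_digraph \<Rightarrow> 'a list \<Rightarrow> bool" where
  "vertex_ordering G vs \<longleftrightarrow> distinct vs \<and> set vs = pverts G"

definition adj_mat :: "'a list \<Rightarrow> 'a pair_pre_digraph \<Rightarrow> real mat" where
  "adj_mat vs G = mat (length vs) (length vs)
     (\<lambda>(i, j). if (vs ! i, vs ! j) \<in> parcs G then 1 else 0)"

definition nnz :: "real mat \<Rightarrow> nat" where
  "nnz E = card {(i, j). i < dim_row E \<and> j < dim_col E \<and> E $$ (i, j) \<noteq> 0}"

text \<open>\<open>vs\<close> is meant to be an ordering of the vertices of \<open>G\<close>; matrix indices start at 0.\<close>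

definition eps_factorization ::
    "real \<Rightarrow> 'a list \<Rightarrow> 'a pair_pre_digraph \<Rightarrow>
     'a pair_pre_digraph \<Rightarrow> 'a pair_pre_digraph \<Rightarrow> real mat \<Rightarrow> bool" where
  "eps_factorization \<epsilon> vs G H K E \<longleftrightarrow>
     0 \<le> \<epsilon> \<and> \<epsilon> \<le> 1 \<and>
     pair_graph H \<and> pverts H = pverts G \<and>
     pair_graph K \<and> pverts K = pverts G \<and>
     E \<in> carrier_mat (length vs) (length vs) \<and> elements_mat E \<subseteq> {0, 1} \<and>
     real (nnz E) \<le> \<epsilon> * (real (length vs))\<^sup>2 \<and>
     (\<forall>i < length vs. \<forall>j < length vs. E $$ (i, j) = 0 \<longrightarrow>
        (adj_mat vs H * adj_mat vs K) $$ (i, j) = adj_mat vs G $$ (i, j))"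

end

theory Submission
  imports Defs
begin

text \<open>
  Entry \<open>(u, v)\<close> of \<open>A(H) A(K)\<close> counts the walks that take one step in \<open>H\<close> and then one in
  \<open>K\<close>. Let \<open>K\<close> be a perfect matching \<open>z \<mapsto> s z\<close> of an even set \<open>Z \<subseteq> Y\<close>, and let
  \<open>H\<close> join \<open>x \<in> X\<close> to \<open>s z\<close> whenever \<open>G\<close> joins \<open>x\<close> to \<open>z \<in> Z\<close>. The matching step at the end
  of a walk undoes the twist by \<open>s\<close>, so the product equals 1 at the arcs of \<open>G\<close> that end in \<open>Z\<close>
  and 0 everywhere else (lemma \<open>card_twist_match_walks\<close>). The errors are therefore exactly the arcs
  of \<open>G\<close> whose head is outside \<open>Z\<close>.

  As \<open>G\<close> is bipartite, every edge gives exactly one arc with head in \<open>X\<close>. For \<open>Z = Y\<close> this makes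
  \<open>m\<close> errors; for \<open>Z = Y - {y0}\<close> the arcs into \<open>y0\<close> add another \<open>degree G y0\<close> errors.
\<close>

lemma pair_graph_iff:
  "pair_graph D \<longleftrightarrow> finite (pverts D) \<and> parcs D \<subseteq> pverts D \<times> pverts D \<and>
     sym (parcs D) \<and> irrefl (parcs D)"
proof
  assume "pair_graph D"
  then interpret pair_graph D .
  show "finite (pverts D) \<and> parcs D \<subseteq> pverts D \<times> pverts D \<and> sym (parcs D) \<and> irrefl (parcs D)"
    using pair_finite_verts in_arcsD1 in_arcsD2 pair_sym_arcs pair_no_loops
    by (fastforce simp: symmetric_def irrefl_def)
next
  assume *: "finite (pverts D) \<and> parcs D \<subseteq> pverts D \<times> pverts D \<and> sym (parcs D) \<and> irrefl (parcs D)"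
  then have "finite (parcs D)"
    by (meson finite_SigmaI finite_subset)
  with * show "pair_graph D"
    by unfold_locales (auto simp: symmetric_def irrefl_def)
qed

section \<open>Adjacency matrices\<close>

lemma adj_mat_index [simp]:
  assumes "i < length vs" "j < length vs"
  shows "adj_mat vs D $$ (i, j) = (if (vs ! i, vs ! j) \<in> parcs D then 1 else 0)"
  using assms by (simp add: adj_mat_def)

lemma adj_mat_carrier [simp]: "adj_mat vs D \<in> carrier_mat (length vs) (length vs)"
  by (simp add: adj_mat_def)

lemma adj_mat_times_index:
  assumes "distinct vs" "i < length vs" "j < length vs"
  shows "(adj_mat vs H * adj_mat vs K) $$ (i, j) =
     real (card {w \<in> set vs. (vs ! i, w) \<in> parcs H \<and> (w, vs ! j) \<in> parcs K})"
proof -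
  let ?P = "\<lambda>w. (vs ! i, w) \<in> parcs H \<and> (w, vs ! j) \<in> parcs K"
  have "(adj_mat vs H * adj_mat vs K) $$ (i, j) = (\<Sum>k<length vs. of_bool (?P (vs ! k)))"
    using assms
    by (auto simp: adj_mat_def scalar_prod_def lessThan_atLeast0 of_bool_def
        simp del: sum_of_bool_eq intro!: sum.cong)
  also have "\<dots> = (\<Sum>w\<in>set vs. of_bool (?P w))"
    using assms(1) by (intro sum.reindex_bij_betw bij_betw_nth) auto
  also have "\<dots> = real (card {w \<in> set vs. ?P w})"
    by (simp add: Int_def)
  finally show ?thesis .
qed

lemma nnz_adj_mat:
  assumes "distinct vs" "parcs D \<subseteq> set vs \<times> set vs"
  shows "nnz (adj_mat vs D) = card (parcs D)"
proof -
  let ?I = "{(i, j). i < length vs \<and> j < length vs \<and> (vs ! i, vs ! j) \<in> parcs D}"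
  have "bij_betw (\<lambda>(i, j). (vs ! i, vs ! j)) ?I (parcs D)"
    unfolding bij_betw_def
  proof
    show "inj_on (\<lambda>(i, j). (vs ! i, vs ! j)) ?I"
      using assms(1) by (auto simp: inj_on_def nth_eq_iff_index_eq)
    show "(\<lambda>(i, j). (vs ! i, vs ! j)) ` ?I = parcs D"
    proof (intro subset_antisym subrelI)
      fix u v assume uv: "(u, v) \<in> parcs D"
      with assms(2) obtain i j where "i < length vs" "j < length vs" "u = vs ! i" "v = vs ! j"
        by (metis in_set_conv_nth mem_Sigma_iff subsetD)
      with uv show "(u, v) \<in> (\<lambda>(i, j). (vs ! i, vs ! j)) ` ?I"
        by (auto intro!: image_eqI[where x = "(i, j)"])
    qed auto
  qed
  moreover have "{(i, j). i < dim_row (adj_mat vs D) \<and> j < dim_col (adj_mat vs D) \<and>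
      adj_mat vs D $$ (i, j) \<noteq> 0} = ?I"
    by (auto simp: adj_mat_def split: if_splits)
  ultimately show ?thesis
    unfolding nnz_def by (simp add: bij_betw_same_card)
qed

section \<open>The twisted graph and the matching\<close>

lemma even_card_fixpoint_free_involution:
  assumes "finite Z" "even (card Z)"
  obtains s where "\<And>z. z \<in> Z \<Longrightarrow> s z \<in> Z" "\<And>z. z \<in> Z \<Longrightarrow> s z \<noteq> z" "\<And>z. z \<in> Z \<Longrightarrow> s (s z) = z"
proof -
  obtain f where f: "bij_betw f Z {0..<card Z}"
    using ex_bij_betw_finite_nat[OF assms(1)] by blast
  let ?g = "inv_into Z f"
  \<comment> \<open>Number the elements from 0 and exchange \<open>2 k\<close> with \<open>2 k + 1\<close>.\<close>
  define t where "t i = (if even i then i + 1 else i - 1)" for i :: nat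
  have t: "t i < card Z" "t i \<noteq> i" "t (t i) = i" if "i < card Z" for i
    using that assms(2) by (auto simp: t_def elim!: oddE evenE)
  have fZ: "f z < card Z" if "z \<in> Z" for z
    using f that by (auto simp: bij_betw_def)
  have g: "?g i \<in> Z" "f (?g i) = i" if "i < card Z" for i
    using f that by (auto simp: bij_betw_def inv_into_into f_inv_into_f)
  have gf: "?g (f z) = z" if "z \<in> Z" for z
    using f that by (simp add: bij_betw_inv_into_left)
  show thesis
  proof (rule that[of "\<lambda>z. ?g (t (f z))"])
    fix z assume z: "z \<in> Z"
    show "?g (t (f z)) \<in> Z" "?g (t (f (?g (t (f z))))) = z"
      using z by (simp_all add: g t fZ gf)
    show "?g (t (f z)) \<noteq> z"
      using z by (metis g(2) t(1,2) fZ)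
  qed
qed

definition matching_graph :: "'a set \<Rightarrow> 'a set \<Rightarrow> ('a \<Rightarrow> 'a) \<Rightarrow> 'a pair_pre_digraph" where
  "matching_graph V Z s = \<lparr>pverts = V, parcs = {(z, s z) | z. z \<in> Z}\<rparr>"

text \<open>
  For an involution \<open>s\<close> of \<open>Z\<close>, this is the part of \<open>G\<close> between \<open>X\<close> and \<open>Z\<close> with every end
  \<open>z \<in> Z\<close> moved to \<open>s z\<close>.
\<close>
definition twisted_graph ::
    "'a pair_pre_digraph \<Rightarrow> 'a set \<Rightarrow> 'a set \<Rightarrow> ('a \<Rightarrow> 'a) \<Rightarrow> 'a pair_pre_digraph" where
  "twisted_graph G X Z s = \<lparr>pverts = pverts G,
     parcs = (let R = {(x, w). x \<in> X \<and> w \<in> Z \<and> (x, s w) \<in> parcs G} in R \<union> R\<inverse>)\<rparr>"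

lemma pair_graph_matching_graph:
  assumes "finite V" "Z \<subseteq> V"
    and "\<And>z. z \<in> Z \<Longrightarrow> s z \<in> Z" "\<And>z. z \<in> Z \<Longrightarrow> s z \<noteq> z" "\<And>z. z \<in> Z \<Longrightarrow> s (s z) = z"
  shows "pair_graph (matching_graph V Z s)"
proof -
  have "sym {(z, s z) | z. z \<in> Z}"
    using assms(3,5) by (auto intro!: symI)
  moreover have "irrefl {(z, s z) | z. z \<in> Z}"
    using assms(4) by (force simp: irrefl_def)
  ultimately show ?thesis
    using assms(1-3) by (auto simp: pair_graph_iff matching_graph_def)
qed

lemma pair_graph_twisted_graph:
  assumes "finite (pverts G)" "X \<subseteq> pverts G" "Z \<subseteq> pverts G" "X \<inter> Z = {}"
  shows "pair_graph (twisted_graph G X Z s)"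
  using assms
  by (auto simp: pair_graph_iff twisted_graph_def Let_def sym_Un_converse irrefl_def)

text \<open>
  A walk that ends in the matching must leave \<open>H\<close> at \<open>s v\<close>, so at most one walk exists from \<open>u\<close>
  to \<open>v\<close>, and since \<open>s (s v) = v\<close> its first step is an edge of \<open>H\<close> iff \<open>(u, v)\<close> is an arc of \<open>G\<close>.
\<close>
lemma card_twist_match_walks:
  assumes "bipartition G X Y" "Z \<subseteq> Y"
    and "\<And>z. z \<in> Z \<Longrightarrow> s z \<in> Z" "\<And>z. z \<in> Z \<Longrightarrow> s (s z) = z"
  shows "card {w \<in> pverts G. (u, w) \<in> parcs (twisted_graph G X Z s) \<and>
           (w, v) \<in> parcs (matching_graph V Z s)} = of_bool ((u, v) \<in> parcs G \<and> v \<in> Z)"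
proof -
  have "{w \<in> pverts G. (u, w) \<in> parcs (twisted_graph G X Z s) \<and>
           (w, v) \<in> parcs (matching_graph V Z s)} =
        (if (u, v) \<in> parcs G \<and> v \<in> Z then {s v} else {})"
  proof (cases "(u, v) \<in> parcs G \<and> v \<in> Z")
    case True
    with assms have "u \<in> X" "s v \<in> pverts G"
      by (auto simp: bipartition_def)
    with True assms(3,4) show ?thesis
      by (auto simp: twisted_graph_def matching_graph_def Let_def intro!: exI[of _ "s v"])
  next
    case False
    have "(u, v) \<in> parcs G \<and> v \<in> Z"
      if "(u, w) \<in> parcs (twisted_graph G X Z s)" "(w, v) \<in> parcs (matching_graph V Z s)" for w
    proof -
      have w: "w \<in> Z" "v = s w"
        using that(2) by (auto simp: matching_graph_def)
      then have "w \<notin> X"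
        using assms(1,2) by (auto simp: bipartition_def)
      with w that(1) assms(3) show ?thesis
        by (auto simp: twisted_graph_def Let_def)
    qed
    with False show ?thesis
      by auto
  qed
  then show ?thesis
    by simp
qed

text \<open>
  The error matrix is itself an adjacency matrix, that of the digraph of arcs of \<open>G\<close> with head
  outside \<open>Z\<close>. Its nonzero entries are then counted by arcs, and they number at most
  \<open>(length vs)\<^sup>2\<close>, which gives \<open>\<epsilon> \<le> 1\<close>.
\<close>
lemma eps_factorization_outside_even_set:
  assumes "pair_graph G" "bipartition G X Y" "vertex_ordering G vs" "Z \<subseteq> Y" "even (card Z)"
    and c: "c = card {(u, v) \<in> parcs G. v \<notin> Z}"
  shows "\<exists>H K E. eps_factorization (real c / (real (length vs))\<^sup>2) vs G H K E \<and> nnz E = c"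
proof -
  have XY: "X \<subseteq> pverts G" "Y \<subseteq> pverts G" "X \<inter> Y = {}"
    using assms(2) by (auto simp: bipartition_def)
  have vs: "distinct vs" "set vs = pverts G"
    using assms(3) by (auto simp: vertex_ordering_def)
  have G: "finite (pverts G)" "parcs G \<subseteq> pverts G \<times> pverts G"
    using assms(1) by (auto simp: pair_graph_iff)
  have "finite Z"
    using G(1) XY(2) assms(4) by (meson finite_subset)
  then obtain s where s: "\<And>z. z \<in> Z \<Longrightarrow> s z \<in> Z" "\<And>z. z \<in> Z \<Longrightarrow> s z \<noteq> z" "\<And>z. z \<in> Z \<Longrightarrow> s (s z) = z"
    using assms(5) by (rule even_card_fixpoint_free_involution) metis
  define H where "H = twisted_graph G X Z s"
  define K where "K = matching_graph (pverts G) Z s"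
  define D where "D = G\<lparr>parcs := {(u, v) \<in> parcs G. v \<notin> Z}\<rparr>"
  define E where "E = adj_mat vs D"
  have nnz: "nnz E = c"
    using nnz_adj_mat[of vs D] vs G(2) by (auto simp: E_def D_def c)
  have HK: "pair_graph H" "pair_graph K" "pverts H = pverts G" "pverts K = pverts G"
    using pair_graph_twisted_graph[of G X Z s] pair_graph_matching_graph[of "pverts G" Z s]
      G(1) XY assms(4) s
    by (auto simp: H_def K_def twisted_graph_def matching_graph_def)
  have len: "length vs = card (pverts G)"
    using vs distinct_card by metis
  have "c \<le> card (pverts G \<times> pverts G)"
    unfolding c using G by (intro card_mono) auto
  then have c_le: "c \<le> (length vs)\<^sup>2"
    by (simp add: len card_cartesian_product power2_eq_square)
  have eps: "real c / (real (length vs))\<^sup>2 \<le> 1" "real c \<le> real c / (real (length vs))\<^sup>2 * (real (length vs))\<^sup>2"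
    using c_le by (auto simp: divide_le_eq_1 simp flip: of_nat_power)
  have prod: "(adj_mat vs H * adj_mat vs K) $$ (i, j) = adj_mat vs G $$ (i, j)"
    if "i < length vs" "j < length vs" "E $$ (i, j) = 0" for i j
    using that card_twist_match_walks[OF assms(2,4) s(1,3), of "vs ! i" "vs ! j" "pverts G"]
    by (auto simp: adj_mat_times_index vs H_def K_def E_def D_def split: if_splits)
  have "elements_mat E \<subseteq> {0, 1}"
    by (auto simp: E_def dest!: elements_matD) (auto simp: adj_mat_def split: if_splits)
  with HK eps prod nnz have "eps_factorization (real c / (real (length vs))\<^sup>2) vs G H K E"
    by (auto simp: eps_factorization_def E_def)
  with nnz show ?thesis
    by blast
qed

section \<open>Counting the errors\<close>

text \<open>Orienting every edge towards \<open>X\<close> picks one of its two arcs.\<close>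
lemma card_arcs_into_part:
  assumes "pair_graph G" "bipartition G X Y"
  shows "card {(u, v) \<in> parcs G. v \<in> X} = card (edges G)"
proof -
  have "bij_betw (\<lambda>(u, v). {u, v}) {(u, v) \<in> parcs G. v \<in> X} (edges G)"
    unfolding bij_betw_def
  proof
    show "inj_on (\<lambda>(u, v). {u, v}) {(u, v) \<in> parcs G. v \<in> X}"
      using assms(2) by (fastforce simp: inj_on_def bipartition_def doubleton_eq_iff)
    have "{u, v} \<in> (\<lambda>(u, v). {u, v}) ` {(u, v) \<in> parcs G. v \<in> X}" if "(u, v) \<in> parcs G" for u v
    proof (cases "v \<in> X")
      case True
      with that show ?thesis by auto
    next
      case False
      have "(v, u) \<in> parcs G" "u \<in> X"
        using that False assms by (auto simp: pair_graph_iff bipartition_def dest: symD)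
      then show ?thesis
        by (auto intro!: image_eqI[where x = "(v, u)"])
    qed
    then show "(\<lambda>(u, v). {u, v}) ` {(u, v) \<in> parcs G. v \<in> X} = edges G"
      by (auto simp: edges_def)
  qed
  then show ?thesis
    by (rule bij_betw_same_card)
qed

lemma card_arcs_into_vertex:
  assumes "pair_graph G"
  shows "card {(u, v) \<in> parcs G. v = y} = degree G y"
proof -
  have "{(u, v) \<in> parcs G. v = y} = (out_arcs (with_proj G) y)\<inverse>"
    using assms by (auto simp: pair_graph_iff out_arcs_def dest: symD)
  then show ?thesis
    by (simp add: degree_def out_degree_def)
qed

theorem corollary2:
  fixes G :: "'a pair_pre_digraph" and X Y :: "'a set" and vs :: "'a list" and m n :: nat
  assumes "pair_graph G"
    and "bipartition G X Y"
    and "vertex_ordering G vs"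
    and "m = card (edges G)"
    and "n = card (pverts G)"
  shows "(even (card Y) \<longrightarrow>
            (\<exists>H K E. eps_factorization (real m / (real n)\<^sup>2) vs G H K E \<and> nnz E = m))
       \<and> (\<forall>y0 \<in> Y. even (card (Y - {y0})) \<longrightarrow>
            (\<exists>H K E. eps_factorization (real (m + degree G y0) / (real n)\<^sup>2) vs G H K E \<and>
                     nnz E = m + degree G y0))"
proof -
  have n: "n = length vs"
    using assms(3,5) distinct_card by (metis vertex_ordering_def)
  have fin: "finite (parcs G)"
    using assms(1) by (auto simp: pair_graph_iff intro: finite_subset[of _ "pverts G \<times> pverts G"])
  have m: "m = card {(u, v) \<in> parcs G. v \<in> X}"
    using card_arcs_into_part[OF assms(1,2)] assms(4) by simp
  show ?thesis
    unfolding n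
  proof (intro conjI ballI impI)
    assume "even (card Y)"
    moreover have "{(u, v) \<in> parcs G. v \<notin> Y} = {(u, v) \<in> parcs G. v \<in> X}"
      using assms(2) by (auto simp: bipartition_def)
    ultimately show "\<exists>H K E. eps_factorization (real m / (real (length vs))\<^sup>2) vs G H K E \<and> nnz E = m"
      using eps_factorization_outside_even_set[OF assms(1-3), of Y m] m by simp
  next
    fix y0 assume y0: "y0 \<in> Y" and ev: "even (card (Y - {y0}))"
    have "{(u, v) \<in> parcs G. v \<notin> Y - {y0}} =
        {(u, v) \<in> parcs G. v \<in> X} \<union> {(u, v) \<in> parcs G. v = y0}"
      using assms(2) by (auto simp: bipartition_def)
    moreover have "{(u, v) \<in> parcs G. v \<in> X} \<inter> {(u, v) \<in> parcs G. v = y0} = {}"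
      using assms(2) y0 by (auto simp: bipartition_def)
    moreover have "finite {(u, v) \<in> parcs G. v \<in> X}" "finite {(u, v) \<in> parcs G. v = y0}"
      using fin by (auto intro: finite_subset[rotated])
    ultimately have "m + degree G y0 = card {(u, v) \<in> parcs G. v \<notin> Y - {y0}}"
      by (simp add: card_Un_disjoint m card_arcs_into_vertex[OF assms(1)])
    then show "\<exists>H K E. eps_factorization (real (m + degree G y0) / (real (length vs))\<^sup>2) vs G H K E \<and>
        nnz E = m + degree G y0"
      using eps_factorization_outside_even_set[OF assms(1-3), of "Y - {y0}"] ev by blast
  qed
qed

end
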